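(* Let $T$ be a finite tree, and let $S$ be the Seifert matrix of $T$ with respect to an arbitrary enumeration of its vertices. Then the generating function for the Euler characteristics of the Seifert cohomology satisfies $$\Delta(t)=\sum_{n}t^{n}\chi(SH^{\bullet}(T,n))=\det (tS-S^{T}),$$ where $\chi(SH^{\bullet}(T,n))=\sum_k(-1)^k\dim_{\mathbb{F}_2} SH^k(T,n)$ and $S^{T}$ denotes the transpose of $S$.
   Context: Let $T$ be a finite tree. A configuration $C$ on $T$ is a way of marking some vertices of $T$ by pluses and minuses and making some edges of $T$ red such that every vertex of $T$ is either marked by exactly one of the signs $+,-$ (and is then not an end of any red edge), or is unmarked and is the end of exactly one red edge. Let $Q(C)$ be the number of minuses of $C$, and let $E(C)$ be the sum of the number of minuses and the number of red edges. $SC(T)$ is the $\mathbb{F}_2$-vector space with basis the set of all configurations on $T$; $SC^{k}(T,n)$ is the subspace spanned by configurations with $Q(C)=k$, $E(C)=n$. Define a linear map $D:SC(T)\to SC(T)$ on basis elements: $D(C)$ is the sum, over all red edges $e$ of $C$, of the two configurations obtained from $C$ by making $e$ non-red and marking one of its ends by $+$ and the other by $-$ (in the two possible ways). Then $D^2=0$ and $D$ maps $SC^k(T,n)$ to $SC^{k+1}(T,n)$. The Seifert cohomology $SH^{\bullet}(T,n)$ is the cohomology of the complex $(SC^{\bullet}(T,n),D)$. Seifert matrix: given an enumeration of the vertices of $T$, it is the upper-triangular matrix $S=(s_{ij})$ with $s_{ii}=-1$; $s_{ij}=1$ if $i<j$ and the vertices $i$ and $j$ are adjacent in $T$; and $s_{ij}=0$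 otherwise. *)

theory Defs
  imports
    "HOL-Computational_Algebra.Polynomial_FPS"
    "HOL-Library.Groups_Big_Fun"
    "HOL-Library.Z2"
    "HOL-Algebra.AbelCoset"
    "Jordan_Normal_Form.Determinant"
    "Jordan_Normal_Form.VS_Connect"
begin

section \<open>Finite trees\<close>

text \<open>
  A simple graph is given by its vertex set and a set of two-element edges.  The digraph predicate
  \<open>tree\<close> of Graph_Theory is not used: it only excludes directed cycles, and
  an edge together with its reverse is already one.
\<close>

definition simple_graph :: "'a set \<Rightarrow> 'a set set \<Rightarrow> bool" where
  "simple_graph V E \<longleftrightarrow> (\<forall>e\<in>E. \<exists>u\<in>V. \<exists>v\<in>V. u \<noteq> v \<and> e = {u, v})"

definition walk :: "'a set \<Rightarrow> 'a set set \<Rightarrow> 'a list \<Rightarrow> bool" where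
  "walk V E xs \<longleftrightarrow>
     xs \<noteq> [] \<and> set xs \<subseteq> V \<and> (\<forall>i. Suc i < length xs \<longrightarrow> {xs ! i, xs ! Suc i} \<in> E)"

definition connected_graph :: "'a set \<Rightarrow> 'a set set \<Rightarrow> bool" where
  "connected_graph V E \<longleftrightarrow>
     V \<noteq> {} \<and> (\<forall>u\<in>V. \<forall>v\<in>V. \<exists>xs. walk V E xs \<and> hd xs = u \<and> last xs = v)"

definition graph_cycle :: "'a set \<Rightarrow> 'a set set \<Rightarrow> 'a list \<Rightarrow> bool" where
  "graph_cycle V E xs \<longleftrightarrow>
     length xs \<ge> 3 \<and> distinct xs \<and> walk V E xs \<and> {last xs, hd xs} \<in> E"

definition finite_tree :: "'a set \<Rightarrow> 'a set set \<Rightarrow> bool" where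
  "finite_tree V E \<longleftrightarrow>
     finite V \<and> simple_graph V E \<and> connected_graph V E \<and> \<not> (\<exists>xs. graph_cycle V E xs)"


section \<open>Quotient vector spaces\<close>

text \<open>
  The multiplicative part of a module record plays no role in the module axioms; as in
  \<^const>\<open>ring.func_space\<close>, it is filled with the zero vector.
\<close>

definition quotient_module ::
    "('a, 'b, 'c) module_scheme \<Rightarrow> 'b set \<Rightarrow> ('a, 'b set) module" where
  "quotient_module M W =
     \<lparr>carrier = a_rcosets\<^bsub>M\<^esub> W,
      monoid.mult = (\<lambda>X Y. W),
      one = W,
      zero = W,
      add = set_add M,
      module.smult = (\<lambda>a X. \<Union>x\<in>X. W +>\<^bsub>M\<^esub> (a \<odot>\<^bsub>M\<^esub> x))\<rparr>"

lemma quotient_module_vectorspace: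
  assumes V: "vectorspace K V" and W: "VectorSpace.subspace K W V"
  shows "vectorspace K (quotient_module V W)"
proof -
  interpret vectorspace K V by fact
  have sub: "submodule K W V" using W by simp
  have Wc: "W \<subseteq> carrier V" and W0: "\<zero>\<^bsub>V\<^esub> \<in> W"
    and Ws: "\<And>a w. a \<in> carrier K \<Longrightarrow> w \<in> W \<Longrightarrow> a \<odot>\<^bsub>V\<^esub> w \<in> W"
    using sub by (auto simp: submodule_def)
  have "additive_subgroup W V"
  proof (rule additive_subgroup.intro, rule group.subgroupI[OF a_group], goal_cases)
    case (3 w)
    then have "(\<ominus>\<^bsub>K\<^esub> \<one>\<^bsub>K\<^esub>) \<odot>\<^bsub>V\<^esub> w = \<ominus>\<^bsub>V\<^esub> w"
      using Wc by (simp add: smult_l_minus subsetD)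
    then show ?case using Ws[of "\<ominus>\<^bsub>K\<^esub> \<one>\<^bsub>K\<^esub>" w] 3 by (simp add: a_inv_def)
  qed (use sub Wc W0 in \<open>auto simp: submodule_def\<close>)
  then interpret W: abelian_subgroup W V
    by (intro abelian_subgroupI3 abelian_group_axioms)
  have add: "(W +>\<^bsub>V\<^esub> x) <+>\<^bsub>V\<^esub> (W +>\<^bsub>V\<^esub> y) = W +>\<^bsub>V\<^esub> (x \<oplus>\<^bsub>V\<^esub> y)"
    if "x \<in> carrier V" "y \<in> carrier V" for x y
    using that by (rule W.a_rcos_sum)
  have coset_smult: "(\<Union>y\<in>W +>\<^bsub>V\<^esub> x. W +>\<^bsub>V\<^esub> (a \<odot>\<^bsub>V\<^esub> y)) = W +>\<^bsub>V\<^esub> (a \<odot>\<^bsub>V\<^esub> x)"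
    if a: "a \<in> carrier K" and x: "x \<in> carrier V" for a x
  proof -
    have "W +>\<^bsub>V\<^esub> (a \<odot>\<^bsub>V\<^esub> y) = W +>\<^bsub>V\<^esub> (a \<odot>\<^bsub>V\<^esub> x)" if y: "y \<in> W +>\<^bsub>V\<^esub> x" for y
    proof -
      obtain w where w: "w \<in> W" "y = w \<oplus>\<^bsub>V\<^esub> x"
        using y by (auto simp: a_r_coset_def')
      have "a \<odot>\<^bsub>V\<^esub> y \<in> W +>\<^bsub>V\<^esub> (a \<odot>\<^bsub>V\<^esub> x)"
        using w a x Wc Ws[OF a w(1)] by (auto simp: a_r_coset_def' smult_r_distr)
      then show ?thesis
        using a x by (metis W.a_repr_independence' smult_closed)
    qed
    moreover have "x \<in> W +>\<^bsub>V\<^esub> x" using x W.a_rcos_self by blast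
    ultimately show ?thesis by blast
  qed
  have car: "X \<in> a_rcosets\<^bsub>V\<^esub> W \<longleftrightarrow> (\<exists>x\<in>carrier V. X = W +>\<^bsub>V\<^esub> x)" for X
    by (auto simp: A_RCOSETS_def')
  have zero: "W = W +>\<^bsub>V\<^esub> \<zero>\<^bsub>V\<^esub>"
    using Wc by (simp add: a_coset_add_zero)
  let ?Q = "quotient_module V W"
  have simps [simp]: "carrier ?Q = a_rcosets\<^bsub>V\<^esub> W" "\<zero>\<^bsub>?Q\<^esub> = W" "add ?Q = set_add V"
    by (simp_all add: quotient_module_def)
  have smult: "a \<odot>\<^bsub>?Q\<^esub> (W +>\<^bsub>V\<^esub> x) = W +>\<^bsub>V\<^esub> (a \<odot>\<^bsub>V\<^esub> x)"
    if "a \<in> carrier K" "x \<in> carrier V" for a x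
    using coset_smult[OF that] by (simp add: quotient_module_def)
  have "module K ?Q"
  proof (rule module_criteria, goal_cases)
    case 1 then show ?case by (rule R.is_cring)
  next
    case 2 then show ?case using zero by (auto simp: car)
  next
    case 4
    have "(W +>\<^bsub>V\<^esub> x) <+>\<^bsub>V\<^esub> (W +>\<^bsub>V\<^esub> (\<ominus>\<^bsub>V\<^esub> x)) = W" if "x \<in> carrier V" for x
      using that by (simp add: add r_neg flip: zero)
    then show ?case
      unfolding simps by (metis car a_inv_closed)
  next
    case 8
    have "(W +>\<^bsub>V\<^esub> x) <+>\<^bsub>V\<^esub> W = W +>\<^bsub>V\<^esub> x" if "x \<in> carrier V" for x
      using add[OF that, of "\<zero>\<^bsub>V\<^esub>"] that by (simp flip: zero)
    then show ?case by (auto simp: car)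
  next
    case 5
    then show ?case by (auto simp: car smult intro: smult_closed)
  qed (auto simp: car add smult smult_assoc1 smult_l_distr smult_r_distr M.a_ac)
  then show ?thesis
    by (simp add: vectorspace_def field_axioms)
qed


section \<open>Configurations\<close>

record 'a config =
  pluses :: "'a set"
  minuses :: "'a set"
  reds :: "'a set set"

definition configs :: "'a set \<Rightarrow> 'a set set \<Rightarrow> 'a config set" where
  "configs V E = {C. pluses C \<subseteq> V \<and> minuses C \<subseteq> V \<and> reds C \<subseteq> E \<and>
     (\<forall>v\<in>V.
        (v \<in> pluses C \<and> v \<notin> minuses C \<and> \<not> (\<exists>e\<in>reds C. v \<in> e)) \<or>
        (v \<notin> pluses C \<and> v \<in> minuses C \<and> \<not> (\<exists>e\<in>reds C. v \<in> e)) \<or>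
        (v \<notin> pluses C \<and> v \<notin> minuses C \<and> (\<exists>!e. e \<in> reds C \<and> v \<in> e)))}"

definition Q_deg :: "'a config \<Rightarrow> nat" where
  "Q_deg C = card (minuses C)"

definition E_deg :: "'a config \<Rightarrow> nat" where
  "E_deg C = card (minuses C) + card (reds C)"

text \<open>
  For a red edge \<open>e\<close> with ends \<open>u \<noteq> v\<close> this set has exactly two elements, since both orders of
  the ends are allowed.
\<close>

definition resolutions :: "'a config \<Rightarrow> 'a set \<Rightarrow> 'a config set" where
  "resolutions C e =
     {\<lparr>pluses = insert u (pluses C), minuses = insert v (minuses C), reds = reds C - {e}\<rparr> | u v.
        e = {u, v} \<and> u \<noteq> v}"


section \<open>The Seifert complex\<close>

abbreviation F2 :: "bit ring" where
  "F2 \<equiv> class_ring"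

text \<open>A tree has finitely many configurations, so all functions on them are formal linear
  combinations.\<close>

definition SC :: "'a set \<Rightarrow> 'a set set \<Rightarrow> (bit, 'a config \<Rightarrow> bit) module" where
  "SC V E = ring.func_space F2 (configs V E)"

definition config_vec :: "'a set \<Rightarrow> 'a set set \<Rightarrow> 'a config \<Rightarrow> ('a config \<Rightarrow> bit)" where
  "config_vec V E C = (\<lambda>C'\<in>configs V E. if C' = C then 1 else 0)"

definition SC_graded ::
    "'a set \<Rightarrow> 'a set set \<Rightarrow> nat \<Rightarrow> nat \<Rightarrow> ('a config \<Rightarrow> bit) set" where
  "SC_graded V E k n =
     module.span F2 (SC V E) (config_vec V E ` {C \<in> configs V E. Q_deg C = k \<and> E_deg C = n})"

definition diff_basis :: "'a set \<Rightarrow> 'a set set \<Rightarrow> 'a config \<Rightarrow> ('a config \<Rightarrow> bit)" where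
  "diff_basis V E C =
     (\<Oplus>\<^bsub>SC V E\<^esub>e\<in>reds C. \<Oplus>\<^bsub>SC V E\<^esub>C'\<in>resolutions C e. config_vec V E C')"

definition seifert_diff :: "'a set \<Rightarrow> 'a set set \<Rightarrow> ('a config \<Rightarrow> bit) \<Rightarrow> ('a config \<Rightarrow> bit)" where
  "seifert_diff V E f = (\<Oplus>\<^bsub>SC V E\<^esub>C\<in>configs V E. f C \<odot>\<^bsub>SC V E\<^esub> diff_basis V E C)"

definition cocycles ::
    "'a set \<Rightarrow> 'a set set \<Rightarrow> nat \<Rightarrow> nat \<Rightarrow> ('a config \<Rightarrow> bit) set" where
  "cocycles V E k n = {f \<in> SC_graded V E k n. seifert_diff V E f = \<zero>\<^bsub>SC V E\<^esub>}"

fun coboundaries ::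
    "'a set \<Rightarrow> 'a set set \<Rightarrow> nat \<Rightarrow> nat \<Rightarrow> ('a config \<Rightarrow> bit) set" where
  "coboundaries V E 0 n = {\<zero>\<^bsub>SC V E\<^esub>}"
| "coboundaries V E (Suc k) n = seifert_diff V E ` SC_graded V E k n"

definition SH ::
    "'a set \<Rightarrow> 'a set set \<Rightarrow> nat \<Rightarrow> nat \<Rightarrow> (bit, ('a config \<Rightarrow> bit) set) module" where
  "SH V E k n =
     quotient_module ((SC V E)\<lparr>carrier := cocycles V E k n\<rparr>) (coboundaries V E k n)"

text \<open>
  \<^const>\<open>Sum_any\<close> is the sum over all \<open>k\<close> of a finitely supported function; here only
  \<open>k \<le> n\<close> can contribute, because \<open>Q_deg C \<le> E_deg C\<close>.
\<close>

definition euler_char_SH :: "'a set \<Rightarrow> 'a set set \<Rightarrow> nat \<Rightarrow> int" where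
  "euler_char_SH V E n = Sum_any (\<lambda>k. (- 1) ^ k * int (vectorspace.dim F2 (SH V E k n)))"

definition Delta :: "'a set \<Rightarrow> 'a set set \<Rightarrow> int fps" where
  "Delta V E = Abs_fps (\<lambda>n. euler_char_SH V E n)"


section \<open>The Seifert matrix\<close>

definition enumeration :: "'a set \<Rightarrow> (nat \<Rightarrow> 'a) \<Rightarrow> bool" where
  "enumeration V x \<longleftrightarrow> bij_betw x {..<card V} V"

definition seifert_matrix :: "'a set \<Rightarrow> 'a set set \<Rightarrow> (nat \<Rightarrow> 'a) \<Rightarrow> int mat" where
  "seifert_matrix V E x =
     mat (card V) (card V)
       (\<lambda>(i, j). if i = j then - 1 else if i < j \<and> {x i, x j} \<in> E then 1 else 0)"

end

theory Submission
  imports Defs "HOL-Combinatorics.Cycles"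
begin

text \<open>
  Both sides equal \<open>\<Sum>\<^sub>M t\<^bsup>|M|\<^esup> (1 - t)\<^bsup>|V| - 2|M|\<^esup>\<close>, where \<open>M\<close> ranges over the matchings of the tree.

  A finite vector space over \<open>F\<^sub>2\<close> has \<open>2\<^bsup>d\<^esup>\<close> elements, \<open>d\<close> being its dimension, so Lagrange's theorem
  and the homomorphism theorem for finite groups give the dimension formulas which show that the Euler
  characteristic of the cohomology is the one of the complex, namely
  \<open>\<Sum>\<^sub>C (-1)\<^bsup>Q(C)\<^esup> t\<^bsup>E(C)\<^esup>\<close>. A configuration is a matching (its red edges) together with an arbitrary set
  of minuses among the unmatched vertices, and the latter contribute a factor \<open>1 - t\<close> each.

  In the Leibniz expansion of the determinant only permutations moving every vertex to itself or to a
  neighbour survive. A cycle of length at least three of such a permutation would be a cycle of the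
  tree, so these permutations are involutions, that is, matchings; a matched pair contributes
  \<open>- (t \<cdot> (-1)) = t\<close> and a fixed vertex contributes \<open>1 - t\<close>.
\<close>

section \<open>Counting in vector spaces over the field with two elements\<close>

text \<open>As simp rules these turn arithmetic in \<^typ>\<open>bit\<close> into bitwise operations, after which the
  ring lemmas no longer apply.\<close>

declare add_bit_eq_xor [simp del] mult_bit_eq_and [simp del]

lemma bij_betwI_ex1:
  assumes "\<And>y. y \<in> B \<Longrightarrow> \<exists>!x. x \<in> A \<and> f x = y" and "\<And>x. x \<in> A \<Longrightarrow> f x \<in> B"
  shows "bij_betw f A B"
  using assms by (intro bij_betwI') metis+

text \<open>Coordinates with respect to a basis identify the space with the functions from that
  basis to \<open>bit\<close>; this lets cardinalities replace dimensions. A finite carrier is its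
  own finite generating set, so a finite basis exists.\<close>

lemma card_F2_vectorspace:
  fixes M :: "(bit, 'b, 'c) module_scheme"
  assumes "vectorspace F2 M" and finM: "finite (carrier M)"
  shows "card (carrier M) = 2 ^ vectorspace.dim F2 M"
proof -
  interpret vectorspace F2 M by fact
  have "gen_set (carrier M)"
    by (rule equalityI[OF span_is_subset2[OF subset_refl] in_own_span[OF subset_refl]])
  then have fd: "fin_dim"
    unfolding fin_dim_def using finM by (intro exI[of _ "carrier M"]) simp
  obtain B where B: "finite B" "basis B"
    using finite_basis_exists[OF fd] by blast
  have Bc: "B \<subseteq> carrier M"
    using B(2) by (simp add: basis_def)
  \<comment> \<open>Extensional functions have no freedom outside \<open>B\<close>, so the
    coefficient function of a vector is unique.\<close>
  have uniq: "\<exists>!a. a \<in> B \<rightarrow>\<^sub>E (UNIV :: bit set) \<and> lincomb a B = v" if "v \<in> carrier M" for v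
    using basis_criterion[OF B(1) Bc] B(2) that by simp
  have closed: "lincomb a B \<in> carrier M" if "a \<in> B \<rightarrow>\<^sub>E (UNIV :: bit set)" for a
    using that Bc by (intro lincomb_closed) auto
  have "bij_betw (\<lambda>a. lincomb a B) (B \<rightarrow>\<^sub>E (UNIV :: bit set)) (carrier M)"
    by (rule bij_betwI_ex1[OF uniq closed])
  then have "card (carrier M) = card (B \<rightarrow>\<^sub>E (UNIV :: bit set))"
    by (simp add: bij_betw_same_card)
  also have "\<dots> = 2 ^ card B"
  proof -
    have "(UNIV :: bit set) = {0, 1}"
      by auto
    then have "card (UNIV :: bit set) = card {0, 1 :: bit}"
      by (rule arg_cong)
    then show ?thesis
      using B(1) by (simp add: card_PiE numeral_2_eq_2)
  qed
  finally show ?thesis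
    using dim_basis[OF B] by simp
qed

text \<open>Rank-nullity in counting form: the homomorphism theorem identifies the cosets of the
  kernel with the image, and Lagrange's theorem counts the cosets.\<close>

lemma (in group_hom) card_kernel_image:
  "card (kernel G H h) * card (h ` carrier G) = order G"
proof -
  \<comment> \<open>With the codomain shrunk to the image \<open>h\<close> becomes surjective, as
    the homomorphism theorem requires.\<close>
  let ?I = "H\<lparr>carrier := h ` carrier G\<rparr>"
  have "group ?I"
    using img_is_subgroup by (rule H.subgroup_imp_group)
  then interpret I: group_hom G ?I h
    by (intro group_hom.intro group_hom_axioms.intro) (auto simp: hom_def G.is_group)
  have ker: "kernel G ?I h = kernel G H h"
    by (simp add: kernel_def)
  have "card (rcosets kernel G H h) = card (h ` carrier G)"
    using bij_betw_same_card[of "\<lambda>X. the_elem (h ` X)" "rcosets kernel G H h" "h ` carrier G"]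
      I.FactGroup_inj_on I.FactGroup_onto
    by (simp add: bij_betw_def FactGroup_def ker)
  then show ?thesis
    using G.lagrange[OF subgroup_kernel] by (simp add: mult.commute)
qed

text \<open>The carrier of the quotient is the set of cosets of \<open>W\<close> in the additive
  group, so Lagrange's theorem applies. \<open>W\<close> is a subgroup because negation is
  multiplication by the scalar minus one.\<close>

lemma card_quotient_module:
  assumes V: "vectorspace K V" and W: "VectorSpace.subspace K W V"
  shows "card (carrier (quotient_module V W)) * card W = card (carrier V)"
proof -
  interpret vectorspace K V by fact
  have sub: "submodule K W V"
    using W by simp
  have "\<ominus>\<^bsub>V\<^esub> w \<in> W" if w: "w \<in> W" for w
  proof -
    have "(\<ominus>\<^bsub>K\<^esub> \<one>\<^bsub>K\<^esub>) \<odot>\<^bsub>V\<^esub> w = \<ominus>\<^bsub>V\<^esub> w"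
      using submodule.subset[OF sub] w by (simp add: smult_l_minus subsetD)
    then show ?thesis
      using submodule.smult_closed[OF sub _ w, of "\<ominus>\<^bsub>K\<^esub> \<one>\<^bsub>K\<^esub>"] by simp
  qed
  then have "subgroup W (add_monoid V)"
    using submodule.subset[OF sub] submodule.zero_closed[OF sub] submodule.m_closed[OF sub]
    by (intro group.subgroupI[OF a_group]) (auto simp: a_inv_def)
  then have "card (rcosets\<^bsub>add_monoid V\<^esub> W) * card W = order (add_monoid V)"
    by (rule group.lagrange[OF a_group])
  then show ?thesis
    by (simp add: quotient_module_def A_RCOSETS_def order_def)
qed

text \<open>Each inner \<open>b k\<close> occurs in two neighbouring terms with opposite signs. With
  \<open>b k\<close> the dimension of the coboundaries, this removes the rank of the differential
  from the Euler characteristic.\<close>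

lemma telescoping_alternating_sum:
  fixes b :: "nat \<Rightarrow> 'r :: comm_ring_1"
  shows "(\<Sum>k<K. (- 1) ^ k * (b (Suc k) + b k)) = b 0 - (- 1) ^ K * b K"
  by (induction K) (auto simp: algebra_simps)

section \<open>The differential of the Seifert complex\<close>

lemma finite_configs:
  assumes "finite V" and "finite E"
  shows "finite (configs V E)"
proof (rule finite_surj)
  show "finite (Pow V \<times> Pow V \<times> Pow E)"
    using assms by simp
  show "configs V E \<subseteq> (\<lambda>(p, m, r). \<lparr>pluses = p, minuses = m, reds = r\<rparr>) ` (Pow V \<times> Pow V \<times> Pow E)"
  proof
    fix C assume "C \<in> configs V E"
    then show "C \<in> (\<lambda>(p, m, r). \<lparr>pluses = p, minuses = m, reds = r\<rparr>) ` (Pow V \<times> Pow V \<times> Pow E)"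
      by (intro image_eqI[of _ _ "(pluses C, minuses C, reds C)"]) (auto simp: configs_def)
  qed
qed

section \<open>Cochains as functions on configurations\<close>

lemma SC_simps [simp]:
  "carrier (SC V E) = configs V E \<rightarrow>\<^sub>E UNIV"
  "\<zero>\<^bsub>SC V E\<^esub> = (\<lambda>C\<in>configs V E. 0)"
  "f \<oplus>\<^bsub>SC V E\<^esub> g = (\<lambda>C\<in>configs V E. f C + g C)"
  "c \<odot>\<^bsub>SC V E\<^esub> f = (\<lambda>C\<in>configs V E. c * f C)"
  by (simp_all add: SC_def class_ring.func_space_def)

lemma vectorspace_SC: "vectorspace F2 (SC V E)"
proof -
  have "module F2 (SC V E)"
    unfolding SC_def by (rule class_cring.func_space_is_module)
  then show ?thesis
    by (simp add: vectorspace_def class_field)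
qed

text \<open>Addition of cochains is pointwise, so sums in the module become ordinary sums of bits in
  each coordinate; the differential is computed in this form.\<close>

lemma finsum_SC:
  assumes "finite A" and "F \<in> A \<rightarrow> carrier (SC V E)"
  shows "(\<Oplus>\<^bsub>SC V E\<^esub>a\<in>A. F a) = (\<lambda>C\<in>configs V E. \<Sum>a\<in>A. F a C)"
proof -
  interpret vectorspace F2 "SC V E" by (rule vectorspace_SC)
  show ?thesis
    using assms
  proof (induction A)
    case empty
    then show ?case by simp
  next
    case (insert a A)
    then show ?case
      by (subst M.finsum_insert) (auto simp del: add_bit_eq_xor intro!: restrict_ext)
  qed
qed


text \<open>Combinations of the chosen basis vectors vanish off \<open>S\<close>. Conversely, a
  cochain supported in \<open>S\<close> is the plain sum of the basis vectors over its support,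
  because the only nonzero scalar is 1.\<close>

lemma span_config_vec:
  assumes finC: "finite (configs V E)" and S: "S \<subseteq> configs V E"
  shows "module.span F2 (SC V E) (config_vec V E ` S)
    = {f \<in> carrier (SC V E). \<forall>C\<in>configs V E. f C \<noteq> 0 \<longrightarrow> C \<in> S}"
proof -
  interpret vectorspace F2 "SC V E" by (rule vectorspace_SC)
  have vec: "config_vec V E C \<in> carrier (SC V E)" for C
    by (simp add: config_vec_def)
  have fS: "finite S"
    using finC S by (rule finite_subset[rotated])
  have lin: "lincomb a A = (\<lambda>C\<in>configs V E. \<Sum>v\<in>A. a v * v C)"
    if "finite A" "A \<subseteq> carrier (SC V E)" for a A
    unfolding lincomb_def using that by (subst finsum_SC) (auto intro!: restrict_ext sum.cong)
  show ?thesis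
  proof (intro equalityI subsetI)
    fix f assume "f \<in> span (config_vec V E ` S)"
    then obtain a A where A: "finite A" "A \<subseteq> config_vec V E ` S" "f = lincomb a A"
      by (auto simp: span_def)
    have f: "f = (\<lambda>C\<in>configs V E. \<Sum>v\<in>A. a v * v C)"
      using A(2) vec unfolding A(3) by (intro lin[OF A(1)]) blast
    have "v C = 0" if "v \<in> A" "C \<in> configs V E" "C \<notin> S" for v C
      using that A(2) by (auto simp: config_vec_def)
    then have "(\<Sum>v\<in>A. a v * v C) = 0" if "C \<in> configs V E" "C \<notin> S" for C
      using that by (intro sum.neutral) auto
    then show "f \<in> {f \<in> carrier (SC V E). \<forall>C\<in>configs V E. f C \<noteq> 0 \<longrightarrow> C \<in> S}"
      by (auto simp: f simp del: bit_not_zero_iff)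
  next
    fix f assume "f \<in> {f \<in> carrier (SC V E). \<forall>C\<in>configs V E. f C \<noteq> 0 \<longrightarrow> C \<in> S}"
    then have f: "f \<in> configs V E \<rightarrow>\<^sub>E UNIV" "\<And>C. C \<in> configs V E \<Longrightarrow> f C \<noteq> 0 \<Longrightarrow> C \<in> S"
      by auto
    define T where "T = {C \<in> S. f C = 1}"
    have T: "finite T" "T \<subseteq> S" "T \<subseteq> configs V E"
      using fS S by (auto simp: T_def)
    \<comment> \<open>\<open>lincomb\<close> sums over a set of vectors; injectivity turns this into
      a sum over the configurations themselves.\<close>
    have inj: "inj_on (config_vec V E) T"
    proof (rule inj_onI)
      fix C D assume "C \<in> T" "D \<in> T" "config_vec V E C = config_vec V E D"
      then have "config_vec V E C C = config_vec V E D C"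
        by simp
      then show "C = D"
        using \<open>C \<in> T\<close> T(3) by (auto simp: config_vec_def split: if_splits)
    qed
    have "lincomb (\<lambda>_. 1) (config_vec V E ` T)
        = (\<lambda>C\<in>configs V E. \<Sum>D\<in>T. config_vec V E D C)"
      using T vec by (subst lin) (auto simp: sum.reindex[OF inj])
    also have "\<dots> = f"
    proof
      fix C
      show "(\<lambda>C\<in>configs V E. \<Sum>D\<in>T. config_vec V E D C) C = f C"
      proof (cases "C \<in> configs V E")
        case True
        have "(\<Sum>D\<in>T. config_vec V E D C) = (\<Sum>D\<in>T. if C = D then 1 else 0)"
          using True by (intro sum.cong) (auto simp: config_vec_def)
        also have "\<dots> = (if C \<in> T then 1 else 0)"
          using T(1) by simp
        also have "\<dots> = f C"
          using f(2)[OF True] by (cases "f C") (auto simp: T_def)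
        finally show ?thesis
          using True by simp
      qed (use f(1) in \<open>auto simp: PiE_def extensional_def\<close>)
    qed
    finally show "f \<in> span (config_vec V E ` S)"
      using T by (auto simp: span_def intro!: exI[of _ "\<lambda>_. 1"] exI[of _ "config_vec V E ` T"])
  qed
qed

text \<open>The elements of the span are the indicator functions of the subsets of
  \<open>S\<close>.\<close>

lemma card_span_config_vec:
  assumes finC: "finite (configs V E)" and S: "S \<subseteq> configs V E"
  shows "card (module.span F2 (SC V E) (config_vec V E ` S)) = 2 ^ card S"
proof -
  let ?F = "{f \<in> carrier (SC V E). \<forall>C\<in>configs V E. f C \<noteq> 0 \<longrightarrow> C \<in> S}"
  have "bij_betw (\<lambda>A. \<lambda>C\<in>configs V E. of_bool (C \<in> A)) (Pow S) ?F"
  proof (rule bij_betw_byWitness[of _ "\<lambda>f. {C \<in> S. f C = 1}"])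
    show "\<forall>f\<in>?F. (\<lambda>C\<in>configs V E. of_bool (C \<in> {C \<in> S. f C = 1})) = f"
      by (auto simp: fun_eq_iff PiE_def extensional_def)
  qed (use S in auto)
  from bij_betw_same_card[OF this] have "card ?F = 2 ^ card S"
    using finite_subset[OF S finC] by (simp add: card_Pow)
  then show ?thesis
    by (simp only: span_config_vec[OF assms])
qed

lemma mem_SC_graded_iff:
  assumes "finite (configs V E)"
  shows "f \<in> SC_graded V E k n \<longleftrightarrow>
    f \<in> carrier (SC V E) \<and> (\<forall>C\<in>configs V E. f C \<noteq> 0 \<longrightarrow> Q_deg C = k \<and> E_deg C = n)"
  unfolding SC_graded_def by (subst span_config_vec[OF assms]) auto

lemma card_SC_graded:
  assumes "finite (configs V E)"
  shows "card (SC_graded V E k n) = 2 ^ card {C \<in> configs V E. Q_deg C = k \<and> E_deg C = n}"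
  unfolding SC_graded_def by (rule card_span_config_vec[OF assms]) auto

section \<open>Resolving one red edge\<close>

definition resolves :: "'a config \<Rightarrow> 'a config \<Rightarrow> bool" where
  "resolves C C' \<longleftrightarrow> (\<exists>e\<in>reds C. C' \<in> resolutions C e)"

lemma resolves_iff:
  "resolves C C' \<longleftrightarrow> (\<exists>u v. u \<noteq> v \<and> {u, v} \<in> reds C \<and>
     C' = \<lparr>pluses = insert u (pluses C), minuses = insert v (minuses C), reds = reds C - {{u, v}}\<rparr>)"
  unfolding resolves_def resolutions_def by blast

text \<open>The three alternatives in \<open>configs\<close> exclude each other, and an end of a red
  edge can only fall under the last one.\<close>

lemma red_edge_vertex:
  assumes "simple_graph V E" and "C \<in> configs V E" and "e \<in> reds C" and "v \<in> e"
  shows "v \<in> V" and "v \<notin> pluses C" and "v \<notin> minuses C" and "\<And>e'. e' \<in> reds C \<Longrightarrow> v \<in> e' \<Longrightarrow> e' = e"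
proof -
  have "e \<in> E"
    using assms(2,3) by (auto simp: configs_def)
  then show "v \<in> V"
    using assms(1,4) by (auto simp: simple_graph_def)
  then show "v \<notin> pluses C" "v \<notin> minuses C" "\<And>e'. e' \<in> reds C \<Longrightarrow> v \<in> e' \<Longrightarrow> e' = e"
    using assms(2-4) unfolding configs_def by blast+
qed

lemma Q_deg_le_E_deg: "Q_deg C \<le> E_deg C"
  by (simp add: Q_deg_def E_deg_def)

text \<open>Only the ends of the resolved edge change state: they lose their single red edge and
  receive opposite signs. Every other vertex keeps its sign and its red edge.\<close>

lemma resolves_in_configs:
  assumes sg: "simple_graph V E" and C: "C \<in> configs V E" and "resolves C C'"
  shows "C' \<in> configs V E"
proof -
  obtain u v where uv: "u \<noteq> v" "{u, v} \<in> reds C"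
    "C' = \<lparr>pluses = insert u (pluses C), minuses = insert v (minuses C), reds = reds C - {{u, v}}\<rparr>"
    using assms(3) by (auto simp: resolves_iff)
  note u = red_edge_vertex[OF sg C uv(2), of u, simplified]
  note v = red_edge_vertex[OF sg C uv(2), of v, simplified]
  have "(w \<in> pluses C' \<and> w \<notin> minuses C' \<and> \<not> (\<exists>e\<in>reds C'. w \<in> e)) \<or>
        (w \<notin> pluses C' \<and> w \<in> minuses C' \<and> \<not> (\<exists>e\<in>reds C'. w \<in> e)) \<or>
        (w \<notin> pluses C' \<and> w \<notin> minuses C' \<and> (\<exists>!e. e \<in> reds C' \<and> w \<in> e))" if w: "w \<in> V" for w
  proof -
    consider "w = u" | "w = v" | "w \<noteq> u" "w \<noteq> v" by blast
    then show ?thesis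
    proof cases
      case 1
      have "w \<notin> e" if "e \<in> reds C'" for e
        using u(4)[of e] that 1 uv(3) by auto
      then show ?thesis using u(2,3) uv(1,3) 1 by simp
    next
      case 2
      have "w \<notin> e" if "e \<in> reds C'" for e
        using v(4)[of e] that 2 uv(3) by auto
      then show ?thesis using v(2,3) uv(1,3) 2 by simp
    next
      case 3
      then have "e \<in> reds C' \<and> w \<in> e \<longleftrightarrow> e \<in> reds C \<and> w \<in> e" for e
        using uv by auto
      moreover have "w \<in> pluses C' \<longleftrightarrow> w \<in> pluses C" "w \<in> minuses C' \<longleftrightarrow> w \<in> minuses C"
        using 3 uv by auto
      moreover have "(w \<in> pluses C \<and> w \<notin> minuses C \<and> \<not> (\<exists>e. e \<in> reds C \<and> w \<in> e)) \<or>
        (w \<notin> pluses C \<and> w \<in> minuses C \<and> \<not> (\<exists>e. e \<in> reds C \<and> w \<in> e)) \<or>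
        (w \<notin> pluses C \<and> w \<notin> minuses C \<and> (\<exists>!e. e \<in> reds C \<and> w \<in> e))"
        using C w unfolding configs_def by blast
      ultimately show ?thesis
        by (simp only: Bex_def)
    qed
  qed
  moreover have "pluses C' \<subseteq> V" "minuses C' \<subseteq> V" "reds C' \<subseteq> E"
    using C u(1) v(1) uv(3) by (auto simp: configs_def)
  ultimately show ?thesis
    by (simp add: configs_def)
qed

text \<open>One red edge is traded for one minus, and this minus is new because an end of a red edge
  is unmarked.\<close>

lemma resolves_degrees:
  assumes sg: "simple_graph V E" and "finite V" "finite E" and C: "C \<in> configs V E" and "resolves C C'"
  shows "Q_deg C' = Suc (Q_deg C)" and "E_deg C' = E_deg C"
proof -
  obtain u v where uv: "u \<noteq> v" "{u, v} \<in> reds C"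
    "C' = \<lparr>pluses = insert u (pluses C), minuses = insert v (minuses C), reds = reds C - {{u, v}}\<rparr>"
    using assms(5) by (auto simp: resolves_iff)
  have "finite (minuses C)" "finite (reds C)"
    using C assms(2,3) by (auto simp: configs_def intro: finite_subset)
  moreover have "v \<notin> minuses C"
    using red_edge_vertex[OF sg C uv(2), of v] by simp
  moreover have "card (reds C) > 0"
    using uv(2) \<open>finite (reds C)\<close> by (auto simp: card_gt_0_iff)
  ultimately show "Q_deg C' = Suc (Q_deg C)" "E_deg C' = E_deg C"
    using uv by (auto simp: Q_deg_def E_deg_def)
qed

text \<open>Two successive resolutions can be performed in either order; this is why \<open>D\<close> squares to zero
  in characteristic two.\<close>

lemma card_between_resolves:
  assumes sg: "simple_graph V E" and C: "C \<in> configs V E" and R: "resolves C C1" "resolves C1 C2"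
  shows "card {D. resolves C D \<and> resolves D C2} = 2"
proof -
  obtain p m r where Cp: "C = \<lparr>pluses = p, minuses = m, reds = r\<rparr>"
    by (cases C) auto
  obtain u v where uv: "u \<noteq> v" "{u, v} \<in> r"
    "C1 = \<lparr>pluses = insert u p, minuses = insert v m, reds = r - {{u, v}}\<rparr>"
    using R(1) by (auto simp: resolves_iff Cp)
  obtain a b where ab: "a \<noteq> b" "{a, b} \<in> r" "{a, b} \<noteq> {u, v}"
    "C2 = \<lparr>pluses = insert a (insert u p), minuses = insert b (insert v m), reds = r - {{u, v}} - {{a, b}}\<rparr>"
    using R(2) by (auto simp: resolves_iff uv)
  \<comment> \<open>The same two resolutions in the other order: \<open>{a, b}\<close> first, then
    \<open>{u, v}\<close>.\<close>
  define C1' where "C1' = \<lparr>pluses = insert a p, minuses = insert b m, reds = r - {{a, b}}\<rparr>"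
  have fresh: "w \<notin> p" "w \<notin> m" if "w \<in> e" "e \<in> r" for w e
    using red_edge_vertex[OF sg C _ that(1)] that(2) by (auto simp: Cp)
  have same: "e = e'" if "w \<in> e" "e \<in> r" "w \<in> e'" "e' \<in> r" for w e e'
    using red_edge_vertex(4)[OF sg C _ that(3), of e] that by (auto simp: Cp)
  have dist: "a \<noteq> u" "a \<noteq> v" "b \<noteq> u" "b \<noteq> v"
    using same[of a "{a, b}" "{u, v}"] same[of b "{a, b}" "{u, v}"] ab uv by auto
  \<comment> \<open>The first edge resolved on the way to \<open>C2\<close> must be missing from
    \<open>C2\<close>, which leaves two choices. Its orientation is then read off from the signs in
    \<open>C2\<close>, the four ends being distinct.\<close>
  have only: "D = C1 \<or> D = C1'" if D: "resolves C D" "resolves D C2" for D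
  proof -
    obtain x y where xy: "x \<noteq> y" "{x, y} \<in> r"
      "D = \<lparr>pluses = insert x p, minuses = insert y m, reds = r - {{x, y}}\<rparr>"
      using D(1) by (auto simp: resolves_iff Cp)
    obtain z w where "C2 = \<lparr>pluses = insert z (pluses D), minuses = insert w (minuses D),
        reds = reds D - {{z, w}}\<rparr>"
      using D(2) unfolding resolves_iff by blast
    then have zw: "pluses C2 = insert z (insert x p)" "minuses C2 = insert w (insert y m)"
        "reds C2 = r - {{x, y}} - {{z, w}}"
      by (simp_all add: xy(3))
    have "{x, y} \<notin> reds C2" "x \<in> pluses C2" "y \<in> minuses C2"
      using zw by auto
    then have "{x, y} = {u, v} \<or> {x, y} = {a, b}" "x = a \<or> x = u" "y = b \<or> y = v"
      using xy(2) fresh[of x "{x, y}"] fresh[of y "{x, y}"] by (auto simp: ab(4))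
    then have "x = u \<and> y = v \<or> x = a \<and> y = b"
      using dist by (auto simp: doubleton_eq_iff)
    then show ?thesis
      using xy(3) uv(3) C1'_def by auto
  qed
  have "resolves C C1'"
    using ab by (auto simp: resolves_iff Cp C1'_def)
  moreover have "resolves C1' C2"
    unfolding resolves_iff
  proof (intro exI conjI)
    show "C2 = \<lparr>pluses = insert u (pluses C1'), minuses = insert v (minuses C1'),
        reds = reds C1' - {{u, v}}\<rparr>"
      using ab by (auto simp: C1'_def)
  qed (use ab uv in \<open>auto simp: C1'_def\<close>)
  ultimately have "{D. resolves C D \<and> resolves D C2} = {C1, C1'}"
    using only R by blast
  moreover have "u \<in> pluses C1" "u \<notin> pluses C1'"
    using uv(2,3) dist(1) fresh(1)[of u "{u, v}"] by (simp_all add: C1'_def)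
  then have "C1 \<noteq> C1'"
    by blast
  ultimately show ?thesis
    by simp
qed

section \<open>The differential in coordinates\<close>

context
  fixes V :: "'a set" and E :: "'a set set"
  assumes sg: "simple_graph V E" and finV: "finite V" and finE: "finite E"
begin

lemmas finite_basis_configs = finite_configs[OF finV finE]
lemmas mem_SC_graded = mem_SC_graded_iff[OF finite_basis_configs]

text \<open>This makes \<open>resolves\<close> the matrix of \<open>D\<close>. Nothing cancels
  modulo two: \<open>C\<close> and \<open>C'\<close> determine the resolved edge as the one red edge
  lost, so at most one summand is nonzero at \<open>C'\<close>.\<close>

lemma diff_basis_eq:
  assumes C: "C \<in> configs V E"
  shows "diff_basis V E C = (\<lambda>C'\<in>configs V E. of_bool (resolves C C'))"
proof -
  have finR: "finite (reds C)"
    using C finE by (auto simp: configs_def intro: finite_subset)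
  have sub: "resolutions C e \<subseteq> configs V E" if "e \<in> reds C" for e
    using resolves_in_configs[OF sg C] that by (auto simp: resolves_def)
  have inner: "(\<Oplus>\<^bsub>SC V E\<^esub>C'\<in>resolutions C e. config_vec V E C')
      = (\<lambda>C'\<in>configs V E. of_bool (C' \<in> resolutions C e))" if e: "e \<in> reds C" for e
  proof -
    have fe: "finite (resolutions C e)"
      using sub[OF e] finite_basis_configs by (rule finite_subset)
    have "(\<Sum>C''\<in>resolutions C e. config_vec V E C'' C') = of_bool (C' \<in> resolutions C e)"
      if "C' \<in> configs V E" for C'
    proof -
      have "(\<Sum>C''\<in>resolutions C e. config_vec V E C'' C')
          = (\<Sum>C''\<in>resolutions C e. if C' = C'' then 1 else 0)"
        using that by (intro sum.cong) (auto simp: config_vec_def)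
      then show ?thesis
        using fe by simp
    qed
    then show ?thesis
      using fe by (subst finsum_SC) (auto simp: config_vec_def intro!: restrict_ext)
  qed
  have outer: "(\<Sum>e\<in>reds C. of_bool (C' \<in> resolutions C e)) = (of_bool (resolves C C') :: bit)"
    for C'
  proof (cases "resolves C C'")
    case True
    then obtain e where e: "e \<in> reds C" "C' \<in> resolutions C e"
      by (auto simp: resolves_def)
    have "e' = e" if "e' \<in> reds C" "C' \<in> resolutions C e'" for e'
    proof -
      have "reds C - {e'} = reds C - {e}"
        using that(2) e(2) by (auto simp: resolutions_def)
      then show ?thesis
        using that(1) e(1) by blast
    qed
    then have "C' \<in> resolutions C e' \<longleftrightarrow> e' = e" if "e' \<in> reds C" for e'
      using that e(2) by blast
    then have "(\<Sum>e'\<in>reds C. of_bool (C' \<in> resolutions C e'))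
        = (\<Sum>e'\<in>reds C. if e' = e then 1 else (0 :: bit))"
      by (intro sum.cong refl) simp
    then show ?thesis
      using e finR True by simp
  next
    case False
    then show ?thesis
      by (auto simp: resolves_def intro!: sum.neutral)
  qed
  have "diff_basis V E C
      = (\<Oplus>\<^bsub>SC V E\<^esub>e\<in>reds C. (\<lambda>C'\<in>configs V E. of_bool (C' \<in> resolutions C e)))"
    unfolding diff_basis_def
    by (intro abelian_monoid.finsum_cong' refl inner)
      (auto intro: module.axioms abelian_group.axioms
        vectorspace.axioms(1)[OF vectorspace_SC])
  also have "\<dots> = (\<lambda>C'\<in>configs V E. of_bool (resolves C C'))"
    using finR by (subst finsum_SC) (auto simp flip: outer intro!: restrict_ext)
  finally show ?thesis .
qed

lemma seifert_diff_eq: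
  "seifert_diff V E f =
    (\<lambda>C'\<in>configs V E. \<Sum>C\<in>configs V E. f C * of_bool (resolves C C'))"
proof -
  let ?F = "\<lambda>C. f C \<odot>\<^bsub>SC V E\<^esub> diff_basis V E C"
  have "seifert_diff V E f = (\<lambda>C'\<in>configs V E. \<Sum>C\<in>configs V E. ?F C C')"
    unfolding seifert_diff_def by (rule finsum_SC) (auto simp: finite_basis_configs)
  also have "\<dots> = (\<lambda>C'\<in>configs V E. \<Sum>C\<in>configs V E. f C * of_bool (resolves C C'))"
    by (intro restrict_ext sum.cong refl) (simp add: diff_basis_eq)
  finally show ?thesis .
qed

lemma seifert_diff_add:
  "seifert_diff V E (f \<oplus>\<^bsub>SC V E\<^esub> g) = seifert_diff V E f \<oplus>\<^bsub>SC V E\<^esub> seifert_diff V E g"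
proof -
  have "(\<Sum>C\<in>configs V E. (f \<oplus>\<^bsub>SC V E\<^esub> g) C * of_bool (resolves C C'))
      = (\<Sum>C\<in>configs V E. f C * of_bool (resolves C C') + g C * of_bool (resolves C C'))" for C'
    by (intro sum.cong refl) (simp add: distrib_right)
  then show ?thesis
    unfolding seifert_diff_eq SC_simps(3)
    by (intro restrict_ext) (simp only: sum.distrib restrict_apply' if_True)
qed

lemma seifert_diff_smult:
  "seifert_diff V E (c \<odot>\<^bsub>SC V E\<^esub> f) = c \<odot>\<^bsub>SC V E\<^esub> seifert_diff V E f"
proof -
  have "(\<Sum>C\<in>configs V E. (c \<odot>\<^bsub>SC V E\<^esub> f) C * of_bool (resolves C C'))
      = (\<Sum>C\<in>configs V E. c * (f C * of_bool (resolves C C')))" for C'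
    by (intro sum.cong refl) (simp add: mult.assoc)
  then show ?thesis
    unfolding seifert_diff_eq SC_simps(4)
    by (intro restrict_ext) (simp only: sum_distrib_left restrict_apply' if_True)
qed

text \<open>The coefficient of \<open>C'\<close> in the square of \<open>D\<close> at
  \<open>C\<close> counts the intermediate configurations modulo two, and there are either none or
  exactly two.\<close>

lemma seifert_diff_twice:
  "seifert_diff V E (seifert_diff V E f) = \<zero>\<^bsub>SC V E\<^esub>"
proof -
  let ?K = "configs V E"
  have paths: "(\<Sum>D\<in>?K. of_bool (resolves C D) * of_bool (resolves D C')) = (0 :: bit)"
    if C: "C \<in> ?K" for C C'
  proof -
    let ?M = "{D. resolves C D \<and> resolves D C'}"
    have "?M \<subseteq> ?K"
      using resolves_in_configs[OF sg C] by blast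
    then have "(\<Sum>D\<in>?K. of_bool (resolves C D) * of_bool (resolves D C')) = (\<Sum>D\<in>?M. 1 :: bit)"
      using finite_basis_configs by (intro sum.mono_neutral_cong_right) auto
    also have "\<dots> = of_nat (card ?M)"
      by simp
    also have "\<dots> = 0"
    proof (cases "?M = {}")
      case True
      then show ?thesis
        by (simp only: card.empty of_nat_0)
    next
      case False
      then have "card ?M = 2"
        using card_between_resolves[OF sg C] by blast
      then show ?thesis by simp
    qed
    finally show ?thesis .
  qed
  have "(\<Sum>D\<in>?K. (\<Sum>C\<in>?K. f C * of_bool (resolves C D)) * of_bool (resolves D C')) = 0" for C'
  proof -
    have "(\<Sum>D\<in>?K. (\<Sum>C\<in>?K. f C * of_bool (resolves C D)) * of_bool (resolves D C'))
      = (\<Sum>D\<in>?K. \<Sum>C\<in>?K. f C * (of_bool (resolves C D) * of_bool (resolves D C')))"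
      by (simp only: sum_distrib_right mult.assoc)
    also have "\<dots> = (\<Sum>C\<in>?K. \<Sum>D\<in>?K. f C * (of_bool (resolves C D) * of_bool (resolves D C')))"
      by (rule sum.swap)
    also have "\<dots> = (\<Sum>C\<in>?K. f C * (\<Sum>D\<in>?K. of_bool (resolves C D) * of_bool (resolves D C')))"
      by (simp only: sum_distrib_left)
    also have "\<dots> = 0"
      using paths by (intro sum.neutral) simp
    finally show ?thesis .
  qed
  then show ?thesis
    unfolding seifert_diff_eq by (auto intro!: restrict_ext simp del: sum_mult_of_bool_eq)
qed

lemma seifert_diff_graded:
  assumes f: "f \<in> SC_graded V E k n"
  shows "seifert_diff V E f \<in> SC_graded V E (Suc k) n"
proof -
  have "Q_deg C' = Suc k \<and> E_deg C' = n"
    if "C' \<in> configs V E" "seifert_diff V E f C' \<noteq> 0" for C'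
  proof -
    have "(\<Sum>C\<in>configs V E. f C * of_bool (resolves C C')) \<noteq> 0"
      using that unfolding seifert_diff_eq by simp
    then obtain C where C: "C \<in> configs V E" "f C * of_bool (resolves C C') \<noteq> 0"
      by (rule sum.not_neutral_contains_not_neutral)
    then have "f C \<noteq> 0" "resolves C C'"
      by auto
    then show ?thesis
      using f C(1) resolves_degrees[OF sg finV finE C(1)] unfolding mem_SC_graded by auto
  qed
  then show ?thesis
    unfolding mem_SC_graded by (simp add: seifert_diff_eq)
qed

lemma seifert_diff_zero: "seifert_diff V E \<zero>\<^bsub>SC V E\<^esub> = \<zero>\<^bsub>SC V E\<^esub>"
  using seifert_diff_smult[of 0 "\<zero>\<^bsub>SC V E\<^esub>"] by (simp cong: restrict_cong)

section \<open>The Euler characteristic\<close>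

lemma module_SC: "Module.module F2 (SC V E)"
  by (rule vectorspace.axioms(1)[OF vectorspace_SC])

lemma submodule_SC_graded: "submodule F2 (SC_graded V E k n) (SC V E)"
proof (rule submodule.intro[OF module_SC])
  show "SC_graded V E k n \<subseteq> carrier (SC V E)"
    unfolding mem_SC_graded subset_iff by blast
  show "f \<oplus>\<^bsub>SC V E\<^esub> g \<in> SC_graded V E k n"
    if "f \<in> SC_graded V E k n" "g \<in> SC_graded V E k n" for f g
  proof -
    have "f C \<noteq> 0 \<or> g C \<noteq> 0" if "f C + g C \<noteq> 0" for C
      using that by (metis add_0)
    then show ?thesis
      using that unfolding mem_SC_graded by (simp del: bit_not_zero_iff) blast
  qed
  show "\<zero>\<^bsub>SC V E\<^esub> \<in> SC_graded V E k n"
    unfolding mem_SC_graded by simp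
  show "c \<odot>\<^bsub>SC V E\<^esub> f \<in> SC_graded V E k n" if "f \<in> SC_graded V E k n" for c f
    using that unfolding mem_SC_graded by (simp del: bit_not_zero_iff)
qed

lemma submodule_cocycles: "submodule F2 (cocycles V E k n) (SC V E)"
proof -
  interpret M: Module.module F2 "SC V E" by (rule module_SC)
  interpret G: submodule F2 "SC_graded V E k n" "SC V E" by (rule submodule_SC_graded)
  show ?thesis
  proof (rule submodule.intro[OF module_SC])
    show "cocycles V E k n \<subseteq> carrier (SC V E)"
      using G.subset by (auto simp only: cocycles_def)
    show "f \<oplus>\<^bsub>SC V E\<^esub> g \<in> cocycles V E k n"
      if "f \<in> cocycles V E k n" "g \<in> cocycles V E k n" for f g
      using that G.m_closed M.r_zero[OF M.zero_closed]
      by (simp only: cocycles_def mem_Collect_eq seifert_diff_add simp_thms)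
    show "\<zero>\<^bsub>SC V E\<^esub> \<in> cocycles V E k n"
      using G.zero_closed by (simp only: cocycles_def mem_Collect_eq seifert_diff_zero simp_thms)
    show "c \<odot>\<^bsub>SC V E\<^esub> f \<in> cocycles V E k n"
      if "c \<in> carrier F2" "f \<in> cocycles V E k n" for c f
      using that G.smult_closed M.smult_r_null
      by (simp only: cocycles_def mem_Collect_eq seifert_diff_smult simp_thms)
  qed
qed

lemma submodule_coboundaries: "submodule F2 (coboundaries V E k n) (SC V E)"
proof (cases k)
  case 0
  interpret M: Module.module F2 "SC V E" by (rule module_SC)
  show ?thesis
    unfolding 0 coboundaries.simps
    using M.zero_closed M.r_zero[OF M.zero_closed] M.smult_r_null
    by (intro submodule.intro[OF module_SC]) (simp_all only: singleton_iff insert_subset empty_subsetI simp_thms)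
next
  case (Suc j)
  interpret G: submodule F2 "SC_graded V E j n" "SC V E" by (rule submodule_SC_graded)
  show ?thesis
    unfolding Suc coboundaries.simps
  proof (rule submodule.intro[OF module_SC])
    show "seifert_diff V E ` SC_graded V E j n \<subseteq> carrier (SC V E)"
      by (auto simp: seifert_diff_eq)
    show "f \<oplus>\<^bsub>SC V E\<^esub> g \<in> seifert_diff V E ` SC_graded V E j n"
      if "f \<in> seifert_diff V E ` SC_graded V E j n" "g \<in> seifert_diff V E ` SC_graded V E j n" for f g
      using that by (elim imageE) (simp only: seifert_diff_add[symmetric] imageI G.m_closed)
    show "\<zero>\<^bsub>SC V E\<^esub> \<in> seifert_diff V E ` SC_graded V E j n"
      by (rule image_eqI[where f = "seifert_diff V E", OF seifert_diff_zero[symmetric] G.zero_closed])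
    show "c \<odot>\<^bsub>SC V E\<^esub> f \<in> seifert_diff V E ` SC_graded V E j n"
      if "c \<in> carrier F2" "f \<in> seifert_diff V E ` SC_graded V E j n" for c f
      using that by (elim imageE) (simp only: seifert_diff_smult[symmetric] imageI G.smult_closed)
  qed
qed

lemma coboundaries_subset_cocycles: "coboundaries V E k n \<subseteq> cocycles V E k n"
proof (cases k)
  case 0
  then show ?thesis
    using submodule.zero_closed[OF submodule_cocycles] by simp
next
  case (Suc j)
  then show ?thesis
    using seifert_diff_graded seifert_diff_twice
    by (auto simp only: coboundaries.simps cocycles_def)
qed

lemma vectorspace_submodule:
  assumes "submodule F2 W (SC V E)"
  shows "vectorspace F2 ((SC V E)\<lparr>carrier := W\<rparr>)"
  using module.submodule_is_module[OF module_SC assms] by (simp only: vectorspace_def class_field simp_thms)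

lemma finite_submodule:
  assumes "submodule F2 W (SC V E)"
  shows "finite W"
proof -
  have "finite (UNIV :: bit set)"
    by (rule finite_subset[of _ "{0, 1}"]) auto
  then have "finite (carrier (SC V E))"
    using finite_basis_configs by (simp add: finite_PiE)
  with submodule.subset[OF assms] show ?thesis
    by (rule finite_subset)
qed

text \<open>Lagrange's theorem for cocycles modulo coboundaries, with the order of the quotient
  written as a power of two.\<close>

lemma card_SH:
  "2 ^ vectorspace.dim F2 (SH V E k n) * card (coboundaries V E k n) = card (cocycles V E k n)"
proof -
  let ?Z = "(SC V E)\<lparr>carrier := cocycles V E k n\<rparr>"
  have Z: "vectorspace F2 ?Z"
    by (rule vectorspace_submodule[OF submodule_cocycles])
  have B: "VectorSpace.subspace F2 (coboundaries V E k n) ?Z"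
    using Z coboundaries_subset_cocycles submodule_coboundaries
    by (simp add: VectorSpace.subspace_def submodule_def vectorspace_def del: SC_simps)
  have cq: "card (carrier (SH V E k n)) * card (coboundaries V E k n) = card (cocycles V E k n)"
    using card_quotient_module[OF Z B] by (simp add: SH_def del: SC_simps)
  \<comment> \<open>An infinite set has \<open>card\<close> 0, so a positive product shows that the
    quotient is finite.\<close>
  moreover have "card (cocycles V E k n) > 0"
    using finite_submodule[OF submodule_cocycles] submodule.zero_closed[OF submodule_cocycles]
    by (metis card_gt_0_iff empty_iff)
  ultimately have "finite (carrier (SH V E k n))"
    by (metis card.infinite mult_0 less_irrefl)
  then have "card (carrier (SH V E k n)) = 2 ^ vectorspace.dim F2 (SH V E k n)"
    unfolding SH_def by (rule card_F2_vectorspace[OF quotient_module_vectorspace[OF Z B]])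
  with cq show ?thesis
    by simp
qed

text \<open>Restricted to one graded piece, \<open>D\<close> has the cocycles as its kernel and the
  coboundaries of the next degree as its image.\<close>

lemma card_cocycles_coboundaries:
  "card (cocycles V E k n) * card (coboundaries V E (Suc k) n)
    = 2 ^ card {C \<in> configs V E. Q_deg C = k \<and> E_deg C = n}"
proof -
  let ?G = "(SC V E)\<lparr>carrier := SC_graded V E k n\<rparr>"
  interpret M: Module.module F2 "SC V E" by (rule module_SC)
  interpret G: Module.module F2 ?G
    by (rule module.submodule_is_module[OF module_SC submodule_SC_graded])
  have "seifert_diff V E \<in> hom (add_monoid ?G) (add_monoid (SC V E))"
    using seifert_diff_add submodule.subset[OF submodule_coboundaries, of "Suc k" n]
    by (auto simp: hom_def simp del: SC_simps)
  then interpret h: group_hom "add_monoid ?G" "add_monoid (SC V E)" "seifert_diff V E"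
    by (intro group_hom.intro group_hom_axioms.intro G.a_group M.a_group)
  have "kernel (add_monoid ?G) (add_monoid (SC V E)) (seifert_diff V E) = cocycles V E k n"
    by (simp add: kernel_def cocycles_def del: SC_simps)
  then have "card (cocycles V E k n) * card (coboundaries V E (Suc k) n) = card (SC_graded V E k n)"
    using h.card_kernel_image by (simp add: order_def del: SC_simps)
  then show ?thesis
    by (simp only: card_SC_graded[OF finite_basis_configs])
qed

text \<open>The counting identities become \<open>h k + b k = z k\<close> and
  \<open>z k + b (Suc k) = card (?C k)\<close> for the dimensions. Eliminating \<open>z\<close>, the
  alternating sums for cohomology and cochains differ by a telescoping sum.\<close>

lemma euler_char_SH_eq:
  "euler_char_SH V E n = (\<Sum>C | C \<in> configs V E \<and> E_deg C = n. (- 1) ^ Q_deg C)"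
proof -
  let ?C = "\<lambda>k. {C \<in> configs V E. Q_deg C = k \<and> E_deg C = n}"
  define h where "h k = vectorspace.dim F2 (SH V E k n)" for k
  define z where "z k = vectorspace.dim F2 ((SC V E)\<lparr>carrier := cocycles V E k n\<rparr>)" for k
  define b where "b k = vectorspace.dim F2 ((SC V E)\<lparr>carrier := coboundaries V E k n\<rparr>)" for k
  have z: "card (cocycles V E k n) = 2 ^ z k" for k
    using card_F2_vectorspace[OF vectorspace_submodule[OF submodule_cocycles], of k n]
      finite_submodule[OF submodule_cocycles, of k n] by (simp add: z_def del: SC_simps)
  have b: "card (coboundaries V E k n) = 2 ^ b k" for k
    using card_F2_vectorspace[OF vectorspace_submodule[OF submodule_coboundaries], of k n]
      finite_submodule[OF submodule_coboundaries, of k n] by (simp add: b_def del: SC_simps)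
  have hz: "h k + b k = z k" for k
    using card_SH[of k n] unfolding z b h_def[symmetric] power_add[symmetric] by simp
  have zc: "z k + b (Suc k) = card (?C k)" for k
    using card_cocycles_coboundaries[of k n] unfolding z b power_add[symmetric] by simp
  \<comment> \<open>The only coboundary in degree 0 is the zero cochain; this settles the lower end
    of the telescoping sum.\<close>
  have "(2 :: nat) ^ b 0 = 2 ^ 0"
    using b[of 0] by simp
  then have b0: "b 0 = 0"
    by (subst (asm) power_inject_exp) simp_all
  \<comment> \<open>\<open>Q_deg C \<le> E_deg C\<close> leaves only the zero cochain above degree
    \<open>n\<close>, which bounds the sum and settles the upper end of the telescoping.\<close>
  have vanish: "h k = 0" "b k = 0" if "n < k" for k
  proof -
    have "?C k = {}"
      using that Q_deg_le_E_deg leD by blast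
    then have "card (?C k) = 0"
      by (simp only: card.empty)
    then show "h k = 0" "b k = 0"
      using hz[of k] zc[of k] by simp_all
  qed
  have "euler_char_SH V E n = (\<Sum>k<Suc n. (- 1) ^ k * int (h k))"
    unfolding euler_char_SH_def h_def[symmetric]
  proof (rule Sum_any.expand_superset)
    show "{k. (- 1) ^ k * int (h k) \<noteq> 0} \<subseteq> {..<Suc n}"
    proof
      fix k assume "k \<in> {k. (- 1) ^ k * int (h k) \<noteq> 0}"
      then have "h k \<noteq> 0"
        by simp
      with vanish(1)[of k] show "k \<in> {..<Suc n}"
        by (meson lessThan_iff not_less_eq)
    qed
  qed simp
  also have "\<dots> = (\<Sum>k<Suc n. (- 1) ^ k * int (card (?C k)) - (- 1) ^ k * (int (b (Suc k)) + int (b k)))"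
  proof (intro sum.cong refl)
    fix k
    have "int (h k) = int (card (?C k)) - (int (b (Suc k)) + int (b k))"
      using hz[of k] zc[of k] by linarith
    then show "(- 1) ^ k * int (h k)
        = (- 1) ^ k * int (card (?C k)) - (- 1) ^ k * (int (b (Suc k)) + int (b k))"
      by (simp add: right_diff_distrib)
  qed
  also have "\<dots> = (\<Sum>k<Suc n. (- 1) ^ k * int (card (?C k)))"
    unfolding sum_subtractf telescoping_alternating_sum[of "\<lambda>k. int (b k)"]
    using b0 vanish(2)[of "Suc n"] by simp
  also have "\<dots> = (\<Sum>k<Suc n. \<Sum>C | C \<in> {C \<in> configs V E. E_deg C = n} \<and> Q_deg C = k. (- 1) ^ Q_deg C)"
    by (intro sum.cong refl) (simp add: conj_commute conj_left_commute)
  also have "\<dots> = (\<Sum>C | C \<in> configs V E \<and> E_deg C = n. (- 1) ^ Q_deg C)"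
    using finite_basis_configs Q_deg_le_E_deg
    by (intro sum.group) (auto simp: less_Suc_eq_le)
  finally show ?thesis .
qed

end

section \<open>Matchings and involutions along edges\<close>

text \<open>If \<open>p (p i)\<close> differs from \<open>i\<close>, the orbit of \<open>i\<close>
  has at least three points. Consecutive ones are joined by edges and the orbit closes up, so its
  vertices form a graph cycle.\<close>

lemma permutation_involutive_of_acyclic:
  assumes acyclic: "\<nexists>xs. graph_cycle V E xs" and fin: "finite I" and p: "p permutes I"
    and x: "bij_betw x I V" and adj: "\<And>i. i \<in> I \<Longrightarrow> p i \<noteq> i \<Longrightarrow> {x i, x (p i)} \<in> E"
  shows "p (p i) = i"
proof (rule ccontr)
  assume "p (p i) \<noteq> i"
  then have pi: "p i \<noteq> i" by metis
  then have "i \<in> I"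
    using p by (metis permutes_not_in)
  then have I: "(p ^^ j) i \<in> I" for j
    by (induction j) (simp_all add: permutes_in_image[OF p])
  have perm: "permutation p"
    using p fin by (auto simp: permutation_permutes)
  \<comment> \<open>Powers of \<open>p\<close> are injective, so a fixed iterate would force
    \<open>i\<close> itself to be fixed.\<close>
  have step: "p ((p ^^ j) i) \<noteq> (p ^^ j) i" for j
  proof
    assume "p ((p ^^ j) i) = (p ^^ j) i"
    then have "(p ^^ j) (p i) = (p ^^ j) i"
      by (simp add: funpow_swap1)
    then show False
      using pi permutes_inj[OF permutes_funpow[OF p]] by (simp add: inj_eq)
  qed
  let ?k = "least_power p i"
  have per: "(p ^^ ?k) i = i"
    by (rule least_power_of_permutation(1)[OF perm])
  have "?k \<noteq> 2"
    using per \<open>p (p i) \<noteq> i\<close> by (auto simp: numeral_2_eq_2)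
  with least_power_gt_one[OF perm pi] have k: "?k \<ge> 3"
    by linarith
  \<comment> \<open>\<open>support p i\<close> lists the orbit \<open>i\<close>, \<open>p i\<close>,
    and so on up to exponent \<open>?k - 1\<close>, each point once.\<close>
  define xs where "xs = map x (support p i)"
  have len: "length xs = ?k"
    by (simp add: xs_def)
  have nth: "xs ! j = x ((p ^^ j) i)" if "j < ?k" for j
    using that by (simp add: xs_def)
  have "set (support p i) \<subseteq> I"
    using I by auto
  then have "distinct xs" "set xs \<subseteq> V"
    using cycle_of_permutation[OF perm, of i] x unfolding xs_def distinct_map[of x] set_map[of x]
    by (auto simp: bij_betw_def intro: inj_on_subset)
  moreover have "{xs ! j, xs ! Suc j} \<in> E" if "Suc j < length xs" for j
    using that adj[OF I[of j] step[of j]] by (simp add: len nth)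
  moreover have "xs \<noteq> []"
    using k len by auto
  moreover have "{last xs, hd xs} \<in> E"
  proof -
    have "p ((p ^^ (?k - 1)) i) = i"
      using per k by (cases ?k) auto
    then have "{x ((p ^^ (?k - 1)) i), x i} \<in> E"
      using adj[OF I[of "?k - 1"] step[of "?k - 1"]] by simp
    moreover have "last xs = x ((p ^^ (?k - 1)) i)" "hd xs = x i"
      using k \<open>xs \<noteq> []\<close> by (simp_all add: last_conv_nth hd_conv_nth len nth)
    ultimately show ?thesis
      by simp
  qed
  ultimately have "graph_cycle V E xs"
    using k len by (auto simp: graph_cycle_def walk_def)
  then show False
    using acyclic by blast
qed

text \<open>Induction on the number of moved points. Removing a two-cycle flips the sign, and its
  two factors multiply to \<open>- c\<close>; the minus signs cancel and one \<open>c\<close> splits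
  off.\<close>

lemma sign_prod_involution:
  fixes B :: "'i \<Rightarrow> 'i \<Rightarrow> 'r :: comm_ring_1"
  assumes "finite I" and "p permutes I" and "\<And>i. p (p i) = i"
    and "\<And>i. p i \<noteq> i \<Longrightarrow> B i (p i) * B (p i) i = - c"
  shows "of_int (sign p) * (\<Prod>i | p i \<noteq> i. B i (p i)) = c ^ (card {i. p i \<noteq> i} div 2)"
  using assms(2-4)
proof (induction "card {i. p i \<noteq> i}" arbitrary: p rule: less_induct)
  case (less p)
  show ?case
  proof (cases "{i. p i \<noteq> i} = {}")
    case True
    then have "p = id" by auto
    then show ?thesis by simp
  next
    case False
    then obtain i where i: "p i \<noteq> i" by blast
    define j where "j = p i"
    have j: "j \<noteq> i" "p i = j" "p j = i"
      using i less.prems(2) by (auto simp: j_def)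
    have iI: "i \<in> I" and jI: "j \<in> I"
      using j less.prems(1) by (metis permutes_not_in)+
    \<comment> \<open>Composing with the transposition removes this two-cycle: \<open>q\<close>
      fixes \<open>i\<close> and \<open>j\<close> and agrees with \<open>p\<close>
      elsewhere.\<close>
    define q where "q = transpose i j \<circ> p"
    have q_other: "q k = p k" if "k \<noteq> i" "k \<noteq> j" for k
    proof -
      have "p k \<noteq> i" "p k \<noteq> j"
        using that j less.prems(2) by metis+
      then show ?thesis by (simp add: q_def)
    qed
    have q_fix: "q i = i" "q j = j"
      using j by (simp_all add: q_def)
    have q: "q permutes I"
      unfolding q_def by (rule permutes_compose[OF less.prems(1) permutes_swap_id[OF iI jI]])
    have q_inv: "q (q k) = k" for k
    proof (cases "k = i \<or> k = j")
      case True
      then show ?thesis using q_fix by auto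
    next
      case False
      then have "p k \<noteq> i" "p k \<noteq> j"
        using j less.prems(2) by metis+
      then show ?thesis
        using False less.prems(2) by (simp add: q_other)
    qed
    have fin: "finite {k. p k \<noteq> k}"
      by (rule finite_subset[OF _ assms(1)]) (use less.prems(1) in \<open>auto simp: permutes_def\<close>)
    have "p k \<noteq> k \<longleftrightarrow> k = i \<or> k = j \<or> q k \<noteq> k" for k
      using j q_other[of k] by (cases "k = i \<or> k = j") auto
    then have supp: "{k. p k \<noteq> k} = insert i (insert j {k. q k \<noteq> k})"
      by blast
    have finq: "finite {k. q k \<noteq> k}"
      using fin by (rule finite_subset[rotated]) (auto simp: supp)
    have card: "card {k. p k \<noteq> k} = card {k. q k \<noteq> k} + 2"
      unfolding supp using finq q_fix j(1) by simp
    have IH: "of_int (sign q) * (\<Prod>k | q k \<noteq> k. B k (q k)) = c ^ (card {k. q k \<noteq> k} div 2)"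
    proof (rule less.hyps)
      show "B k (q k) * B (q k) k = - c" if "q k \<noteq> k" for k
        using less.prems(3)[of k] that q_fix q_other by metis
    qed (use card q q_inv in auto)
    have "p = transpose i j \<circ> q"
      by (simp add: q_def fun_eq_iff)
    moreover have "permutation q"
      using q assms(1) by (auto simp: permutation_permutes)
    ultimately have "sign p = sign (transpose i j) * sign q"
      by (simp add: sign_compose[OF permutation_swap_id])
    then have sign: "sign p = - sign q"
      using j(1) by (simp add: sign_swap_id)
    have "(\<Prod>k | p k \<noteq> k. B k (p k)) = B i j * (B j i * (\<Prod>k | q k \<noteq> k. B k (p k)))"
      unfolding supp using finq q_fix j by simp
    also have "(\<Prod>k | q k \<noteq> k. B k (p k)) = (\<Prod>k | q k \<noteq> k. B k (q k))"
    proof (intro prod.cong refl)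
      fix k assume "k \<in> {k. q k \<noteq> k}"
      then have "k \<noteq> i" "k \<noteq> j"
        using q_fix by auto
      then show "B k (p k) = B k (q k)"
        by (simp add: q_other)
    qed
    also have "B i j * (B j i * (\<Prod>k | q k \<noteq> k. B k (q k))) = - c * (\<Prod>k | q k \<noteq> k. B k (q k))"
      using less.prems(3)[OF i] by (simp only: j(2) mult.assoc[symmetric])
    finally have "of_int (sign p) * (\<Prod>k | p k \<noteq> k. B k (p k))
        = c * (of_int (sign q) * (\<Prod>k | q k \<noteq> k. B k (q k)))"
      by (simp add: sign mult.left_commute)
    then show ?thesis
      by (simp add: IH card)
  qed
qed

section \<open>Matchings as involutions along edges\<close>

definition matchings :: "'a set set \<Rightarrow> 'a set set set" where
  "matchings E = {M. M \<subseteq> E \<and> pairwise disjnt M}"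

lemma card_Union_matching:
  assumes "simple_graph V E" and "M \<in> matchings E"
  shows "card (\<Union>M) = 2 * card M"
proof -
  have two: "card e = 2" if "e \<in> M" for e
  proof -
    have "e \<in> E"
      using that assms(2) by (auto simp: matchings_def)
    then obtain u v where "u \<noteq> v" "e = {u, v}"
      using assms(1) by (auto simp: simple_graph_def)
    then show ?thesis
      by simp
  qed
  then have "finite e" if "e \<in> M" for e
    using that by (metis card.infinite zero_neq_numeral)
  then have "card (\<Union>M) = sum card M"
    using assms(2) by (intro card_Union_disjoint) (auto simp: matchings_def)
  then show ?thesis
    using two by simp
qed

text \<open>Edges being unordered, both points of a two-cycle give the same edge; \<open>x\<close>
  carries indices to vertices.\<close>

definition moved_edges :: "('i \<Rightarrow> 'a) \<Rightarrow> ('i \<Rightarrow> 'i) \<Rightarrow> 'a set set" where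
  "moved_edges x p = {{x i, x (p i)} | i. p i \<noteq> i}"

definition edge_involutions :: "'i set \<Rightarrow> ('i \<Rightarrow> 'a) \<Rightarrow> 'a set set \<Rightarrow> ('i \<Rightarrow> 'i) set" where
  "edge_involutions I x E =
     {p. p permutes I \<and> (\<forall>i. p (p i) = i) \<and> (\<forall>i. p i \<noteq> i \<longrightarrow> {x i, x (p i)} \<in> E)}"

text \<open>This recovers an involution from its edges. Injectivity of \<open>x\<close> pulls an
  equality of edges back to index pairs up to order, and an involution treats both orders
  alike.\<close>

lemma edge_mem_moved_edges_iff:
  assumes x: "inj_on x I" and p: "p \<in> edge_involutions I x E" and "i \<in> I" "j \<in> I" "i \<noteq> j"
  shows "{x i, x j} \<in> moved_edges x p \<longleftrightarrow> p i = j"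
proof
  assume "{x i, x j} \<in> moved_edges x p"
  then obtain k where k: "p k \<noteq> k" "{x i, x j} = {x k, x (p k)}"
    by (auto simp: moved_edges_def)
  have inv: "p (p k) = k" and pI: "p permutes I"
    using p by (auto simp: edge_involutions_def)
  have "k \<in> I" "p k \<in> I"
    using k(1) pI permutes_not_in permutes_in_image by metis+
  then have "i = k \<and> j = p k \<or> i = p k \<and> j = k"
    using k(2) assms(3,4) by (auto simp: doubleton_eq_iff inj_on_eq_iff[OF x])
  then show "p i = j"
    using inv by auto
next
  assume "p i = j"
  then show "{x i, x j} \<in> moved_edges x p"
    using assms(5) by (auto simp: moved_edges_def)
qed

text \<open>Distinct two-cycles of an involution share no point, and the injective \<open>x\<close>
  keeps them apart.\<close>

lemma moved_edges_in_matchings: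
  assumes x: "inj_on x I" and p: "p \<in> edge_involutions I x E"
  shows "moved_edges x p \<in> matchings E"
proof -
  have inv: "\<And>k. p (p k) = k" and pI: "p permutes I"
    using p by (auto simp: edge_involutions_def)
  have I: "k \<in> I" "p k \<in> I" if "p k \<noteq> k" for k
    using that pI permutes_not_in permutes_in_image by metis+
  have "disjnt {x i, x (p i)} {x j, x (p j)}"
    if ij: "p i \<noteq> i" "p j \<noteq> j" and ne: "{x i, x (p i)} \<noteq> {x j, x (p j)}" for i j
  proof -
    have "i \<noteq> j" "i \<noteq> p j"
      using ne inv[of j] by (auto simp: insert_commute)
    then have "p i \<noteq> j" "p i \<noteq> p j"
      using inv by metis+
    with \<open>i \<noteq> j\<close> \<open>i \<noteq> p j\<close> show ?thesis
      using I[OF ij(1)] I[OF ij(2)] by (simp add: disjnt_def inj_on_eq_iff[OF x])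
  qed
  then have "pairwise disjnt (moved_edges x p)"
    unfolding pairwise_def moved_edges_def by blast
  moreover have "moved_edges x p \<subseteq> E"
    using p by (auto simp: moved_edges_def edge_involutions_def)
  ultimately show ?thesis
    by (simp add: matchings_def)
qed

text \<open>The inverse sends a matching to the permutation that swaps the two ends of each of its
  edges and fixes everything else.\<close>

lemma bij_betw_moved_edges:
  assumes sg: "simple_graph V E" and x: "bij_betw x I V"
  shows "bij_betw (moved_edges x) (edge_involutions I x E) (matchings E)"
proof (rule bij_betw_imageI)
  have inj: "inj_on x I" and V: "V = x ` I"
    using x by (auto simp: bij_betw_def)
  show "inj_on (moved_edges x) (edge_involutions I x E)"
  proof (rule inj_onI)
    fix p q assume p: "p \<in> edge_involutions I x E" and q: "q \<in> edge_involutions I x E"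
      and eq: "moved_edges x p = moved_edges x q"
    have pI: "p permutes I" and qI: "q permutes I"
      using p q by (auto simp: edge_involutions_def)
    have iff: "p i = j \<longleftrightarrow> q i = j" if "i \<in> I" "j \<in> I" "i \<noteq> j" for i j
      using edge_mem_moved_edges_iff[OF inj p that] edge_mem_moved_edges_iff[OF inj q that] eq by simp
    have "p i = q i" if "i \<in> I" for i
      using iff[OF that, of "p i"] iff[OF that, of "q i"] that
        permutes_in_image[OF pI, of i] permutes_in_image[OF qI, of i] by metis
    then show "p = q"
      using pI qI by (metis ext permutes_not_in)
  qed
  show "moved_edges x ` edge_involutions I x E = matchings E"
  proof (intro equalityI subsetI)
    fix M assume "M \<in> moved_edges x ` edge_involutions I x E"
    then show "M \<in> matchings E"
      using moved_edges_in_matchings[OF inj] by blast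
  next
    fix M assume M: "M \<in> matchings E"
    \<comment> \<open>\<open>R\<close> relates the indices of the two ends of an edge of
      \<open>M\<close>. Disjointness of the edges makes the partner unique, so that
      \<open>THE\<close> picks it; unmatched indices are fixed.\<close>
    define R where "R i j \<longleftrightarrow> i \<in> I \<and> j \<in> I \<and> i \<noteq> j \<and> {x i, x j} \<in> M" for i j
    define p where "p i = (if \<exists>j. R i j then THE j. R i j else i)" for i
    have sym: "R j i" if "R i j" for i j
      using that by (auto simp: R_def insert_commute)
    have uniq: "j = k" if "R i j" "R i k" for i j k
    proof -
      have "{x i, x j} \<in> M" "{x i, x k} \<in> M" "pairwise disjnt M"
        using that M by (simp_all add: R_def matchings_def)
      moreover have "\<not> disjnt {x i, x j} {x i, x k}"
        by (simp add: disjnt_def)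
      ultimately have "{x i, x j} = {x i, x k}"
        by (metis pairwiseD)
      then have "x j = x k"
        by (auto simp: doubleton_eq_iff)
      then show ?thesis
        using that inj_onD[OF inj] by (auto simp: R_def)
    qed
    have pR: "p i = j" if "R i j" for i j
      unfolding p_def using that uniq by (metis the_equality)
    have p_moved: "R i (p i)" if "p i \<noteq> i" for i
      using that pR by (metis p_def)
    have inv: "p (p i) = i" for i
      using p_moved pR sym by metis
    have "p permutes I"
      unfolding permutes_def using inv p_moved R_def by metis
    moreover have "{x i, x (p i)} \<in> M" if "p i \<noteq> i" for i
      using p_moved[OF that] by (simp add: R_def)
    ultimately have "p \<in> edge_involutions I x E" and "moved_edges x p \<subseteq> M"
      using inv M by (auto simp: edge_involutions_def matchings_def moved_edges_def)
    moreover have "M \<subseteq> moved_edges x p"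
    proof
      fix e assume e: "e \<in> M"
      obtain i j where ij: "i \<in> I" "j \<in> I" "x i \<noteq> x j" "e = {x i, x j}"
      proof -
        have "e \<in> E"
          using e M by (auto simp: matchings_def)
        then obtain u v where "u \<in> V" "v \<in> V" "u \<noteq> v" "e = {u, v}"
          using sg unfolding simple_graph_def by blast
        with that show thesis
          unfolding V by blast
      qed
      then have "i \<noteq> j"
        by blast
      then have "R i j"
        using e ij unfolding R_def by simp
      then have "p i = j"
        by (rule pR)
      then show "e \<in> moved_edges x p"
        unfolding moved_edges_def using ij(4) \<open>i \<noteq> j\<close> by (intro CollectI exI[of _ i]) simp
    qed
    ultimately have "M = moved_edges x p"
      by (intro equalityI)
    then show "M \<in> moved_edges x ` edge_involutions I x E"
      using \<open>p \<in> edge_involutions I x E\<close> by (rule image_eqI)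
  qed
qed

text \<open>The moved points correspond to the vertices covered by the matching, two for each
  edge.\<close>

lemma card_moved:
  assumes sg: "simple_graph V E" and x: "inj_on x I" and p: "p \<in> edge_involutions I x E"
  shows "card {i. p i \<noteq> i} = 2 * card (moved_edges x p)"
proof -
  have inv: "\<And>k. p (p k) = k" and pI: "p permutes I"
    using p by (auto simp: edge_involutions_def)
  have sub: "{i. p i \<noteq> i} \<subseteq> I"
    using pI by (auto simp: permutes_def)
  have "\<Union>(moved_edges x p) = x ` {i. p i \<noteq> i}"
  proof (intro equalityI subsetI)
    fix w assume "w \<in> \<Union>(moved_edges x p)"
    then obtain i where i: "p i \<noteq> i" "w = x i \<or> w = x (p i)"
      by (auto simp: moved_edges_def)
    then have "p (p i) \<noteq> p i"
      using inv[of i] by simp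
    with i show "w \<in> x ` {i. p i \<noteq> i}"
      by blast
  qed (auto simp: moved_edges_def)
  then have "card (\<Union>(moved_edges x p)) = card {i. p i \<noteq> i}"
    using card_image[OF inj_on_subset[OF x sub]] by simp
  then show ?thesis
    using card_Union_matching[OF sg moved_edges_in_matchings[OF x p]] by simp
qed

section \<open>Generating function and determinant\<close>

lemma reds_in_matchings:
  assumes sg: "simple_graph V E" and C: "C \<in> configs V E"
  shows "reds C \<in> matchings E"
proof -
  have "disjnt e e'" if "e \<in> reds C" "e' \<in> reds C" "e \<noteq> e'" for e e'
    using red_edge_vertex(4)[OF sg C that(1) _ that(2)] that(3) by (auto simp: disjnt_iff)
  then have "pairwise disjnt (reds C)"
    by (rule pairwiseI)
  moreover have "reds C \<subseteq> E"
    using C by (auto simp: configs_def)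
  ultimately show ?thesis
    by (simp add: matchings_def)
qed

lemma config_of_matching:
  assumes M: "M \<in> matchings E" and A: "A \<subseteq> V - \<Union>M"
  shows "\<lparr>pluses = V - \<Union>M - A, minuses = A, reds = M\<rparr> \<in> configs V E"
proof -
  have "e = e'" if "e \<in> M" "e' \<in> M" "v \<in> e" "v \<in> e'" for e e' v
    using M that by (auto simp: matchings_def pairwise_def disjnt_iff)
  then have "\<exists>!e. e \<in> M \<and> v \<in> e" if "v \<in> \<Union>M" for v
    using that by blast
  then show ?thesis
    using M A by (auto simp: configs_def matchings_def)
qed

lemma config_signs_unmatched:
  assumes C: "C \<in> configs V E"
  shows "minuses C \<subseteq> V - \<Union>(reds C)" and "pluses C = V - \<Union>(reds C) - minuses C"
proof -
  have *: "pluses C \<subseteq> V" "minuses C \<subseteq> V"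
    "\<And>v. v \<in> V \<Longrightarrow> (v \<in> pluses C \<and> v \<notin> minuses C \<and> v \<notin> \<Union>(reds C)) \<or>
        (v \<notin> pluses C \<and> v \<in> minuses C \<and> v \<notin> \<Union>(reds C)) \<or>
        (v \<notin> pluses C \<and> v \<notin> minuses C \<and> v \<in> \<Union>(reds C))"
    using C unfolding configs_def by blast+
  then show "minuses C \<subseteq> V - \<Union>(reds C)" "pluses C = V - \<Union>(reds C) - minuses C"
    by blast+
qed

text \<open>The pluses carry no extra information: they are the unmatched vertices that are not
  minuses. Any set of unmatched vertices may serve as the minuses.\<close>

lemma bij_betw_configs:
  assumes sg: "simple_graph V E"
  shows "bij_betw (\<lambda>C. (reds C, minuses C)) (configs V E) (SIGMA M:matchings E. Pow (V - \<Union>M))"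
proof (rule bij_betw_byWitness[of _ "\<lambda>(M, A). \<lparr>pluses = V - \<Union>M - A, minuses = A, reds = M\<rparr>"])
  show "(\<lambda>C. (reds C, minuses C)) ` configs V E \<subseteq> (SIGMA M:matchings E. Pow (V - \<Union>M))"
    using reds_in_matchings[OF sg] config_signs_unmatched(1) by blast
  show "(\<lambda>(M, A). \<lparr>pluses = V - \<Union>M - A, minuses = A, reds = M\<rparr>) `
      (SIGMA M:matchings E. Pow (V - \<Union>M)) \<subseteq> configs V E"
    using config_of_matching by (auto simp del: Diff_iff)
  show "\<forall>C\<in>configs V E. (case (reds C, minuses C) of
      (M, A) \<Rightarrow> \<lparr>pluses = V - \<Union>M - A, minuses = A, reds = M\<rparr>) = C"
  proof
    fix C assume "C \<in> configs V E"
    from config_signs_unmatched(2)[OF this, symmetric]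
    show "(case (reds C, minuses C) of
      (M, A) \<Rightarrow> \<lparr>pluses = V - \<Union>M - A, minuses = A, reds = M\<rparr>) = C"
      by simp
  qed
qed auto

lemma config_generating_function:
  assumes sg: "simple_graph V E" and finV: "finite V" and finE: "finite E"
  shows "(\<Sum>C\<in>configs V E. monom ((- 1) ^ Q_deg C) (E_deg C) :: int poly)
    = (\<Sum>M\<in>matchings E. monom 1 1 ^ card M * (1 - monom 1 1) ^ (card V - 2 * card M))"
proof -
  have finM: "finite (matchings E)"
    by (rule finite_subset[of _ "Pow E"]) (auto simp: matchings_def finE)
  have "(\<Sum>C\<in>configs V E. monom ((- 1) ^ Q_deg C) (E_deg C) :: int poly)
      = (\<Sum>C\<in>configs V E. case (reds C, minuses C) of (M, A) \<Rightarrow>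
          monom ((- 1) ^ card A) (card A + card M))"
    by (simp add: Q_deg_def E_deg_def)
  also have "\<dots> = (\<Sum>(M, A)\<in>(SIGMA M:matchings E. Pow (V - \<Union>M)).
      monom ((- 1) ^ card A) (card A + card M))"
    by (rule sum.reindex_bij_betw[OF bij_betw_configs[OF sg]])
  also have "\<dots> = (\<Sum>M\<in>matchings E. \<Sum>A\<in>Pow (V - \<Union>M). monom ((- 1) ^ card A) (card A + card M))"
    using finM finV by (intro sum.Sigma[symmetric]) auto
  also have "\<dots> = (\<Sum>M\<in>matchings E. monom 1 1 ^ card M * (1 - monom 1 1) ^ (card V - 2 * card M))"
  proof (intro sum.cong refl)
    fix M assume M: "M \<in> matchings E"
    have "\<Union>M \<subseteq> V"
      using M sg by (fastforce simp: matchings_def simple_graph_def)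
    then have card: "card (V - \<Union>M) = card V - 2 * card M"
      using card_Diff_subset[of "\<Union>M" V] finite_subset[OF _ finV] card_Union_matching[OF sg M] by simp
    \<comment> \<open>With \<open>monom 1 1\<close> as the variable, a minus enters both gradings
      and carries a negated variable, while a red edge only raises \<open>E_deg\<close>.\<close>
    have signed_monom: "monom ((- 1) ^ k) (k + m) = monom 1 1 ^ m * (- monom 1 1 :: int poly) ^ k" for k m
      by (simp add: monom_power minus_monom mult_monom add.commute)
    have "(1 - monom 1 1 :: int poly) ^ card (V - \<Union>M) = (\<Prod>v\<in>V - \<Union>M. - monom 1 1 + 1)"
      by simp
    \<comment> \<open>In the expanded product, \<open>A\<close> records the vertices where
      \<open>- monom 1 1\<close> is chosen rather than 1.\<close>
    also have "\<dots> = (\<Sum>A\<in>Pow (V - \<Union>M). (- monom 1 1) ^ card A)"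
      using finV by (subst prod_add) auto
    finally show "(\<Sum>A\<in>Pow (V - \<Union>M). monom ((- 1) ^ card A) (card A + card M))
        = monom 1 1 ^ card M * (1 - monom 1 1 :: int poly) ^ (card V - 2 * card M)"
      by (simp add: signed_monom card sum_distrib_left)
  qed
  finally show ?thesis .
qed

section \<open>The determinant by the Leibniz formula\<close>

lemma det_seifert_matrix:
  fixes S :: "int mat"
  assumes tree: "finite_tree V E" and x: "enumeration V x" and S: "S = seifert_matrix V E x"
  shows "det ((monom 1 1 :: int poly) \<cdot>\<^sub>m map_mat of_int S - transpose_mat (map_mat of_int S))
    = (\<Sum>M\<in>matchings E. monom 1 1 ^ card M * (1 - monom 1 1) ^ (card V - 2 * card M))"
proof -
  define n where "n = card V"
  define I where "I = {0..<n}"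
  let ?t = "monom 1 1 :: int poly"
  define A where "A = ?t \<cdot>\<^sub>m map_mat of_int S - transpose_mat (map_mat of_int S)"
  have sg: "simple_graph V E" and acyclic: "\<nexists>xs. graph_cycle V E xs"
    using tree by (auto simp: finite_tree_def)
  have bij: "bij_betw x I V"
    using x by (simp add: enumeration_def I_def n_def lessThan_atLeast0)
  have finI: "finite I" and cardI: "card I = n"
    by (simp_all add: I_def)
  have A: "A \<in> carrier_mat n n"
    by (intro carrier_matI) (simp_all add: A_def S seifert_matrix_def n_def)
  have diag: "A $$ (i, i) = 1 - ?t" if "i \<in> I" for i
    using that by (simp add: A_def S seifert_matrix_def n_def I_def)
  have nonadj: "A $$ (i, j) = 0" if "i \<in> I" "j \<in> I" "i \<noteq> j" "{x i, x j} \<notin> E" for i j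
    using that by (simp add: A_def S seifert_matrix_def n_def I_def insert_commute)
  \<comment> \<open>For adjacent vertices the entry above the diagonal is \<open>?t\<close> and the
    one below is -1, so the product is the same whichever index is smaller.\<close>
  have adj: "A $$ (i, j) * A $$ (j, i) = - ?t" if "i \<in> I" "j \<in> I" "i \<noteq> j" "{x i, x j} \<in> E" for i j
    using that by (cases i j rule: linorder_cases)
      (simp_all add: A_def S seifert_matrix_def n_def I_def insert_commute)
  let ?w = "\<lambda>p. of_int (sign p) * (\<Prod>i\<in>I. A $$ (i, p i))"
  have permI: "p permutes I" if "p \<in> edge_involutions I x E" for p
    using that by (simp add: edge_involutions_def)
  have "det A = (\<Sum>p | p permutes I. ?w p)"
    unfolding I_def by (rule det_def'[OF A])
  also have "\<dots> = (\<Sum>p\<in>edge_involutions I x E. ?w p)"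
  proof (intro sum.mono_neutral_right ballI)
    show "finite {p. p permutes I}"
      using finI by (rule finite_permutations)
    show "edge_involutions I x E \<subseteq> {p. p permutes I}"
      using permI by blast
    fix p assume p: "p \<in> {p. p permutes I} - edge_involutions I x E"
    then have pI: "p permutes I"
      by blast
    \<comment> \<open>If every moved point went to a neighbour, acyclicity would make
      \<open>p\<close> an involution along edges. So some factor is a zero entry.\<close>
    obtain i where i: "i \<in> I" "p i \<noteq> i" "{x i, x (p i)} \<notin> E"
    proof (rule ccontr)
      assume "\<not> thesis"
      then have "{x i, x (p i)} \<in> E" if "i \<in> I" "p i \<noteq> i" for i
        using that \<open>\<And>i. i \<in> I \<Longrightarrow> p i \<noteq> i \<Longrightarrow> {x i, x (p i)} \<notin> E \<Longrightarrow> thesis\<close> by blast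
      moreover from this have "p (p i) = i" for i
        by (rule permutation_involutive_of_acyclic[OF acyclic finI pI bij])
      moreover have "i \<in> I" if "p i \<noteq> i" for i
        using that permutes_not_in[OF pI] by blast
      ultimately have "p \<in> edge_involutions I x E"
        using pI by (simp add: edge_involutions_def)
      then show False
        using p by blast
    qed
    then have "A $$ (i, p i) = 0"
      using permutes_in_image[OF pI] by (intro nonadj) auto
    then have "(\<Prod>i\<in>I. A $$ (i, p i)) = 0"
      using finI i(1) by (intro prod_zero) auto
    then show "?w p = 0"
      by simp
  qed
  also have "\<dots> = (\<Sum>p\<in>edge_involutions I x E.
      ?t ^ card (moved_edges x p) * (1 - ?t) ^ (n - 2 * card (moved_edges x p)))"
  proof (intro sum.cong refl)
    fix p assume p: "p \<in> edge_involutions I x E"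
    have pI: "p permutes I" and inv: "\<And>i. p (p i) = i"
      and edge: "\<And>i. p i \<noteq> i \<Longrightarrow> {x i, x (p i)} \<in> E"
      using p by (auto simp: edge_involutions_def)
    let ?M = "{i. p i \<noteq> i}"
    have sub: "?M \<subseteq> I"
      using pI by (auto simp: permutes_def)
    have card: "card ?M = 2 * card (moved_edges x p)"
      using bij by (intro card_moved[OF sg _ p]) (simp add: bij_betw_def)
    \<comment> \<open>The product is split: fixed points meet the diagonal, while moved points
      together with the sign give one \<open>?t\<close> per edge.\<close>
    have "(\<Prod>i\<in>I - ?M. A $$ (i, p i)) = (\<Prod>i\<in>I - ?M. 1 - ?t)"
      using diag by (intro prod.cong refl) auto
    also have "\<dots> = (1 - ?t) ^ (n - 2 * card (moved_edges x p))"
      using card_Diff_subset[OF finite_subset[OF sub finI] sub] by (simp add: card cardI)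
    finally have fixed: "(\<Prod>i\<in>I - ?M. A $$ (i, p i)) = (1 - ?t) ^ (n - 2 * card (moved_edges x p))" .
    have "A $$ (i, p i) * A $$ (p i, i) = - ?t" if "p i \<noteq> i" for i
    proof -
      have "i \<in> I"
        using that sub by blast
      then show ?thesis
        using that edge[OF that] permutes_in_image[OF pI, of i] by (intro adj) auto
    qed
    then have "of_int (sign p) * (\<Prod>i\<in>?M. A $$ (i, p i)) = ?t ^ (card ?M div 2)"
      by (rule sign_prod_involution[OF finI pI inv])
    then have "of_int (sign p) * (\<Prod>i\<in>?M. A $$ (i, p i)) = ?t ^ card (moved_edges x p)"
      by (simp add: card)
    moreover have "(\<Prod>i\<in>I. A $$ (i, p i)) = (\<Prod>i\<in>I - ?M. A $$ (i, p i)) * (\<Prod>i\<in>?M. A $$ (i, p i))"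
      by (rule prod.subset_diff[OF sub finI])
    ultimately show "?w p = ?t ^ card (moved_edges x p) * (1 - ?t) ^ (n - 2 * card (moved_edges x p))"
      by (simp only: fixed mult.assoc[symmetric] mult.commute)
  qed
  also have "\<dots> = (\<Sum>M\<in>matchings E. ?t ^ card M * (1 - ?t) ^ (n - 2 * card M))"
    by (rule sum.reindex_bij_betw[OF bij_betw_moved_edges[OF sg bij]])
  finally show ?thesis
    by (simp only: A_def n_def)
qed

theorem theorem2:
  fixes V :: "'a set" and E :: "'a set set" and x :: "nat \<Rightarrow> 'a" and S :: "int mat"
  assumes "finite_tree V E"
    and "enumeration V x"
    and "S = seifert_matrix V E x"
  shows "Delta V E =
    fps_of_poly (det ((monom 1 1 :: int poly) \<cdot>\<^sub>m map_mat of_int S - transpose_mat (map_mat of_int S)))"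
proof -
  have sg: "simple_graph V E" and finV: "finite V"
    using assms(1) by (auto simp: finite_tree_def)
  have "E \<subseteq> Pow V"
    using sg by (auto simp: simple_graph_def)
  then have finE: "finite E"
    by (rule finite_subset) (simp add: finV)
  \<comment> \<open>Coefficientwise, each configuration contributes one signed monomial at exponent
    \<open>E_deg C\<close>; there are finitely many, so the series is a polynomial.\<close>
  have "Delta V E = fps_of_poly (\<Sum>C\<in>configs V E. monom ((- 1) ^ Q_deg C) (E_deg C))"
  proof (rule fps_ext)
    fix n
    have "euler_char_SH V E n = (\<Sum>C | C \<in> configs V E \<and> E_deg C = n. (- 1) ^ Q_deg C)"
      by (rule euler_char_SH_eq[OF sg finV finE])
    also have "\<dots> = (\<Sum>C\<in>configs V E. if E_deg C = n then (- 1) ^ Q_deg C else 0)"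
      by (rule sum.inter_filter[OF finite_configs[OF finV finE]])
    finally show "fps_nth (Delta V E) n
        = fps_nth (fps_of_poly (\<Sum>C\<in>configs V E. monom ((- 1) ^ Q_deg C) (E_deg C))) n"
      by (simp add: Delta_def coeff_sum)
  qed
  then show ?thesis
    by (simp only: config_generating_function[OF sg finV finE] det_seifert_matrix[OF assms])
qed

end
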